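(* Let $p=3$, let $c\in\mathbb{Z}_3$ with $c\in D(-2,1/9)$ (i.e. $|c+2|_3\le 1/9$), and let $f_c(z)=z^2+c$. If $k$ is an integer such that $$c\equiv -2 \pmod{3^k}\qquad\text{but}\qquad c\not\equiv -2\pmod{3^{k+1}},$$ then $0$ has orbit type $(2,3^i)$ (mod $3^{k+i}$) under $f_c$ for every $i\geq 1$.
   Context: $D(a,r)=\{x:|x-a|\le r\}$ is the closed disk for the $3$-adic absolute value. The orbit type of $0$ (mod $3^j$) under $f_c$ is the minimal pair $(m,n)$ with $m\ge 0$, $n\ge 1$ and $f_c^{m+n}(0)\equiv f_c^m(0)$ (mod $3^j$), where $f_c^i$ denotes the $i$-th iterate; that is, $m$ is the tail length and $n$ the exact length of the cycle reached by $0$ under the map induced by $f_c$ on $\mathbb{Z}_3/3^j\mathbb{Z}_3$. *)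

theory Defs
  imports Complex_Main
begin

text \<open>The ring of 3-adic integers, as the inverse limit of the rings of integers modulo \<open>3 ^ n\<close>.
  The residue of \<open>x\<close> modulo \<open>3 ^ n\<close> is represented by the integer \<open>x n\<close> with \<open>0 \<le> x n < 3 ^ n\<close>.\<close>

typedef z3 = "{x :: nat \<Rightarrow> int. \<forall>n. x n = x (Suc n) mod 3 ^ n}"
  by (rule exI [of _ "\<lambda>_. 0"]) simp

setup_lifting type_definition_z3

lemma mod_3_pow_Suc: "(a :: int) mod 3 ^ Suc n mod 3 ^ n = a mod 3 ^ n"
  by (rule mod_mod_cancel) simp

lemma coherent_add:
  fixes x y :: "nat \<Rightarrow> int"
  assumes x: "\<And>n. x n = x (Suc n) mod 3 ^ n" and y: "\<And>n. y n = y (Suc n) mod 3 ^ n"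
  shows "(x n + y n) mod 3 ^ n = (x (Suc n) + y (Suc n)) mod 3 ^ Suc n mod 3 ^ n"
  unfolding mod_3_pow_Suc x [of n] y [of n] by (rule mod_add_eq)

lemma coherent_diff:
  fixes x y :: "nat \<Rightarrow> int"
  assumes x: "\<And>n. x n = x (Suc n) mod 3 ^ n" and y: "\<And>n. y n = y (Suc n) mod 3 ^ n"
  shows "(x n - y n) mod 3 ^ n = (x (Suc n) - y (Suc n)) mod 3 ^ Suc n mod 3 ^ n"
  unfolding mod_3_pow_Suc x [of n] y [of n] by (rule mod_diff_eq)

lemma coherent_mult:
  fixes x y :: "nat \<Rightarrow> int"
  assumes x: "\<And>n. x n = x (Suc n) mod 3 ^ n" and y: "\<And>n. y n = y (Suc n) mod 3 ^ n"
  shows "(x n * y n) mod 3 ^ n = (x (Suc n) * y (Suc n)) mod 3 ^ Suc n mod 3 ^ n"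
  unfolding mod_3_pow_Suc x [of n] y [of n] by (rule mod_mult_eq)

lemma coherent_minus:
  fixes x :: "nat \<Rightarrow> int"
  assumes x: "\<And>n. x n = x (Suc n) mod 3 ^ n"
  shows "- x n mod 3 ^ n = - x (Suc n) mod 3 ^ Suc n mod 3 ^ n"
  unfolding mod_3_pow_Suc x [of n] by (rule mod_minus_eq)

lemma Rep_z3_Suc: "Rep_z3 x (Suc n) mod 3 ^ n = Rep_z3 x n"
  using Rep_z3 [of x] by (metis (mono_tags, lifting) mem_Collect_eq)

lemma Rep_z3_mod: "Rep_z3 x n mod 3 ^ n = Rep_z3 x n"
  by (subst (1 2) Rep_z3_Suc [symmetric]) (rule mod_mod_trivial)

lemma z3_eqI: "(\<And>n. Rep_z3 x n = Rep_z3 y n) \<Longrightarrow> x = y"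
  by (metis Rep_z3_inject ext)

instantiation z3 :: comm_ring_1
begin

lift_definition zero_z3 :: z3 is "\<lambda>_. 0"
  by simp

lift_definition one_z3 :: z3 is "\<lambda>n. 1 mod 3 ^ n"
  by (simp only: mod_3_pow_Suc)

lift_definition plus_z3 :: "z3 \<Rightarrow> z3 \<Rightarrow> z3" is "\<lambda>x y n. (x n + y n) mod 3 ^ n"
  by (rule coherent_add; blast)

lift_definition minus_z3 :: "z3 \<Rightarrow> z3 \<Rightarrow> z3" is "\<lambda>x y n. (x n - y n) mod 3 ^ n"
  by (rule coherent_diff; blast)

lift_definition uminus_z3 :: "z3 \<Rightarrow> z3" is "\<lambda>x n. (- x n) mod 3 ^ n"
  by (rule coherent_minus; blast)

lift_definition times_z3 :: "z3 \<Rightarrow> z3 \<Rightarrow> z3" is "\<lambda>x y n. (x n * y n) mod 3 ^ n"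
  by (rule coherent_mult; blast)

lemmas z3_rep_eqs = zero_z3.rep_eq one_z3.rep_eq plus_z3.rep_eq minus_z3.rep_eq
  uminus_z3.rep_eq times_z3.rep_eq

instance
proof
  fix a b c :: z3
  show "a * b * c = a * (b * c)"
    by (rule z3_eqI) (simp add: z3_rep_eqs mod_mult_left_eq mod_mult_right_eq mult.assoc)
  show "a * b = b * a"
    by (rule z3_eqI) (simp add: z3_rep_eqs mult.commute)
  show "1 * a = a"
    by (rule z3_eqI) (simp add: z3_rep_eqs mod_mult_left_eq Rep_z3_mod)
  show "a + b + c = a + (b + c)"
    by (rule z3_eqI) (simp add: z3_rep_eqs mod_add_left_eq mod_add_right_eq add.assoc)
  show "a + b = b + a"
    by (rule z3_eqI) (simp add: z3_rep_eqs add.commute)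
  show "0 + a = a"
    by (rule z3_eqI) (simp add: z3_rep_eqs Rep_z3_mod)
  show "- a + a = 0"
    by (rule z3_eqI) (simp add: z3_rep_eqs mod_add_left_eq)
  show "a - b = a + - b"
    by (rule z3_eqI) (simp add: z3_rep_eqs mod_add_right_eq)
  show "(a + b) * c = a * c + b * c"
    by (rule z3_eqI) (simp add: z3_rep_eqs mod_mult_left_eq mod_add_eq distrib_right)
  show "(0 :: z3) \<noteq> 1"
    by transfer (auto dest!: fun_cong [of _ _ 1])
qed

end

definition val3 :: "z3 \<Rightarrow> nat" where
  "val3 x = (GREATEST n. 3 ^ n dvd x)"

definition abs3 :: "z3 \<Rightarrow> real" where
  "abs3 x = (if x = 0 then 0 else 1 / 3 ^ val3 x)"

definition disk3 :: "z3 \<Rightarrow> real \<Rightarrow> z3 set" where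
  "disk3 a r = {x. abs3 (x - a) \<le> r}"

definition quad :: "'a :: comm_ring_1 \<Rightarrow> 'a \<Rightarrow> 'a" where
  "quad c z = z ^ 2 + c"

definition cong_mod :: "'a :: comm_ring_1 \<Rightarrow> 'a \<Rightarrow> 'a \<Rightarrow> bool" where
  "cong_mod N x y \<longleftrightarrow> N dvd x - y"

text \<open>Minimality of \<open>(m, n)\<close> is componentwise: \<open>m\<close> is the tail length and \<open>n\<close> the exact length of the
  cycle that \<open>x\<close> reaches modulo \<open>N\<close>.\<close>

definition has_orbit_type ::
    "('a :: comm_ring_1 \<Rightarrow> 'a) \<Rightarrow> 'a \<Rightarrow> 'a \<Rightarrow> nat \<times> nat \<Rightarrow> bool" where
  "has_orbit_type f x N = (\<lambda>(m, n).
     n \<ge> 1 \<and> cong_mod N ((f ^^ (m + n)) x) ((f ^^ m) x) \<and>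
     (\<forall>m' n'. n' \<ge> 1 \<and> cong_mod N ((f ^^ (m' + n')) x) ((f ^^ m') x) \<longrightarrow> m \<le> m' \<and> n \<le> n'))"

text \<open>The maximum in \<^const>\<open>val3\<close> is attained for every nonzero argument.\<close>

lemma Rep_z3_numeral_pow: "Rep_z3 (3 ^ n) m = 3 ^ n mod 3 ^ m"
proof (induction n)
  case 0
  show ?case by (simp add: one_z3.rep_eq)
next
  case (Suc n)
  have "(3 :: z3) = 1 + 1 + 1" by simp
  then have "Rep_z3 3 m = 3 mod 3 ^ m"
    by (simp only: plus_z3.rep_eq one_z3.rep_eq) (simp add: mod_simps)
  then show ?case
    using Suc by (simp add: times_z3.rep_eq mod_mult_eq)
qed

lemma pow_dvd_imp_Rep_z3: "3 ^ n dvd x \<Longrightarrow> Rep_z3 x n = 0"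
  by (auto simp: dvd_def times_z3.rep_eq Rep_z3_numeral_pow)

lemma Rep_z3_le: "m \<le> n \<Longrightarrow> Rep_z3 x n mod 3 ^ m = Rep_z3 x m"
proof (induction n rule: dec_induct)
  case base
  show ?case by (rule Rep_z3_mod)
next
  case (step n)
  then show ?case
    by (metis Rep_z3_Suc le_imp_power_dvd mod_mod_cancel)
qed

lemma pow_dvd_val3:
  assumes "x \<noteq> 0"
  shows "3 ^ n dvd x \<longleftrightarrow> n \<le> val3 x"
proof -
  obtain N where N: "Rep_z3 x N \<noteq> 0"
    using assms by (metis Rep_z3_inject zero_z3.rep_eq ext)
  have bd: "m \<le> N" if "3 ^ m dvd x" for m
  proof (rule ccontr)
    assume "\<not> m \<le> N"
    then have "Rep_z3 x m mod 3 ^ N = Rep_z3 x N" by (intro Rep_z3_le) simp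
    with pow_dvd_imp_Rep_z3 [OF that] N show False by simp
  qed
  have "3 ^ val3 x dvd x"
    unfolding val3_def by (rule GreatestI_nat [of _ 0 N]) (use bd in auto)
  moreover have "m \<le> val3 x" if "3 ^ m dvd x" for m
    unfolding val3_def by (rule Greatest_le_nat [of _ m N]) (use bd that in auto)
  ultimately show ?thesis
    by (meson dvd_trans le_imp_power_dvd)
qed

lemma abs3_le_iff: "abs3 x \<le> 1 / 3 ^ n \<longleftrightarrow> 3 ^ n dvd x"
proof (cases "x = 0")
  case False
  then show ?thesis
    by (simp add: abs3_def pow_dvd_val3 field_simps)
qed (simp add: abs3_def)

end

theory Submission
  imports Defs "HOL-Computational_Algebra.Primes"
begin

text \<open>Write \<open>c = t - 2\<close>, so that \<open>9\<close> divides \<open>t\<close> and \<open>t\<close> is exactly divisible by \<open>3 ^ k\<close>.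
  For \<open>t = 0\<close> the orbit of \<open>0\<close> is \<open>0, -2, 2, 2, \<dots>\<close>; for general \<open>t\<close> the orbit enters the
  residue class of \<open>2\<close> modulo \<open>t\<close> at the second step and stays there. Modulo \<open>3\<close> the orbit is
  \<open>0, 1, 2, 2, \<dots>\<close>, so neither of the first two points is ever revisited, and the tail has length
  at least \<open>2\<close>.

  On the class of \<open>2\<close>, the identity \<open>f x - f y = (x - y) * (x + y)\<close> shows that each application
  of \<open>f\<close> multiplies differences by a factor congruent to \<open>4\<close> modulo \<open>9\<close>. Hence if
  \<open>d = (f ^^ N) x - x\<close>, then
  \<open>(f ^^ (3 * N)) x - x\<close> equals \<open>d * (1 + 4 ^ N + 16 ^ N)\<close> up to multiples of \<open>9 * d\<close>, and the
  factor in parentheses is congruent to \<open>3\<close> modulo \<open>9\<close>. So tripling the number of steps gains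
  exactly one power of \<open>3\<close>.
  Since one step moves a point by \<open>t\<close> up to multiples of \<open>3 * t\<close>, it follows that
  \<open>3 ^ j * q\<close> steps move it by \<open>3 ^ j * t * q\<close> up to multiples of \<open>3 ^ (j + 1) * t\<close>
  (lemma \<open>quad_funpow_displacement\<close>). When \<open>3\<close> does not divide \<open>q\<close> this is divisible by
  \<open>3 ^ (k + j)\<close> but not by \<open>3 ^ (k + j + 1)\<close>, so every period modulo \<open>3 ^ (k + i)\<close> is a multiple
  of \<open>3 ^ i\<close>, and \<open>3 ^ i\<close> is one.

  The displacement formula holds in every commutative ring in which \<open>9\<close> divides \<open>t\<close>; special
  to the 3-adic integers are only that \<open>3\<close> is not a zero divisor and does not divide \<open>1\<close>.\<close>

section \<open>The orbit in the residue class of 2\<close>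

lemma quad_diff: "quad c x - quad c y = (x - y) * (x + y)"
  by (simp add: quad_def power2_eq_square algebra_simps)

lemma quad_near_2:
  fixes t x :: "'a :: comm_ring_1"
  assumes "t dvd x - 2"
  shows "t dvd quad (t - 2) x - 2"
proof -
  have "quad (t - 2) x - 2 = (x - 2) * (x + 2) + t"
    by (simp add: quad_def power2_eq_square algebra_simps)
  with assms show ?thesis by simp
qed

lemma quad_funpow_near_2:
  fixes t x :: "'a :: comm_ring_1"
  assumes "t dvd x - 2"
  shows "t dvd (quad (t - 2) ^^ n) x - 2"
  by (induction n) (simp_all add: assms quad_near_2)

lemma quad_orbit_0_near_2:
  fixes t :: "'a :: comm_ring_1"
  assumes "m \<ge> 2"
  shows "t dvd (quad (t - 2) ^^ m) 0 - 2"
proof -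
  have "(quad (t - 2) ^^ 2) 0 = quad (t - 2) (quad (t - 2) 0)" by (simp add: eval_nat_numeral)
  also have "\<dots> - 2 = t * (t - 3)"
    by (simp add: quad_def power2_eq_square algebra_simps)
  finally have "t dvd (quad (t - 2) ^^ 2) 0 - 2" by simp
  from quad_funpow_near_2 [OF this, of "m - 2"]
  have "t dvd (quad (t - 2) ^^ (m - 2 + 2)) 0 - 2" by (simp only: funpow_add comp_apply)
  moreover have "m - 2 + 2 = m" using assms by simp
  ultimately show ?thesis by (simp only:)
qed

text \<open>The factor is the product of the sums \<open>x + y\<close> along the two orbits, each of them congruent
  to \<open>2 + 2\<close>. Precision \<open>9\<close> rather than \<open>3\<close> is what makes the three factors in
  \<open>quad_funpow_pow3\<close> add up to a number divisible by \<open>3\<close> exactly once.\<close>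

lemma quad_funpow_diff:
  fixes t x y :: "'a :: comm_ring_1"
  assumes "9 dvd t" and x: "t dvd x - 2" and y: "t dvd y - 2"
  shows "\<exists>e. (quad (t - 2) ^^ n) x - (quad (t - 2) ^^ n) y = (x - y) * (4 ^ n + 9 * e)"
proof (induction n)
  case 0
  show ?case by (rule exI [of _ 0]) simp
next
  case (Suc n)
  define X Y where "X = (quad (t - 2) ^^ n) x" and "Y = (quad (t - 2) ^^ n) y"
  from Suc obtain e where e: "X - Y = (x - y) * (4 ^ n + 9 * e)"
    unfolding X_def Y_def by blast
  have "9 dvd X - 2" "9 dvd Y - 2"
    using quad_funpow_near_2 [OF x, of n] quad_funpow_near_2 [OF y, of n] \<open>9 dvd t\<close>
    unfolding X_def Y_def by (auto intro: dvd_trans)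
  then have "9 dvd (X - 2) + (Y - 2)" by (rule dvd_add)
  then obtain d where "(X - 2) + (Y - 2) = 9 * d" by (rule dvdE)
  then have "X + Y = 4 + 9 * d" by (simp add: algebra_simps)
  then have "quad (t - 2) X - quad (t - 2) Y
      = (x - y) * (4 ^ Suc n + 9 * (4 * e + 4 ^ n * d + 9 * e * d))"
    by (simp add: quad_diff e algebra_simps)
  then show ?case unfolding X_def Y_def funpow.simps comp_apply by blast
qed

section \<open>Displacement after many steps\<close>

lemma pow4_mod_3: "\<exists>a. (4 :: 'a :: comm_ring_1) ^ n = 1 + 3 * a"
proof (induction n)
  case 0
  show ?case by (rule exI [of _ 0]) simp
next
  case (Suc n)
  then obtain a where "(4 :: 'a) ^ n = 1 + 3 * a" by blast
  then have "(4 :: 'a) ^ Suc n = 1 + 3 * (1 + 4 * a)" by (simp add: algebra_simps)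
  then show ?case by blast
qed

text \<open>Tripling the number of steps multiplies the displacement by \<open>3\<close>, up to a factor congruent
  to \<open>1\<close> modulo \<open>3\<close>: with \<open>4 ^ N = 1 + 3 * a\<close>, the sum \<open>1 + 4 ^ N + 16 ^ N\<close> equals
  \<open>3 * (1 + 3 * (a + a\<^sup>2))\<close>.\<close>

lemma quad_funpow_pow3:
  fixes t x :: "'a :: comm_ring_1"
  assumes "9 dvd t" and "t dvd x - 2"
  shows "\<exists>e. (quad (t - 2) ^^ (3 ^ j)) x - x = 3 ^ j * t * (1 + 3 * e)"
proof (induction j)
  case 0
  obtain a where a: "x - 2 = t * a" using assms(2) by (rule dvdE)
  obtain b where b: "t = 9 * b" using assms(1) by (rule dvdE)
  have "quad (t - 2) x - x = t + 3 * (x - 2) + (x - 2) * (x - 2)"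
    by (simp add: quad_def power2_eq_square algebra_simps)
  also have "\<dots> = t * (1 + 3 * a + t * (a * a))"
    unfolding a by (simp add: algebra_simps)
  also have "\<dots> = t * (1 + 3 * (a + 3 * b * (a * a)))"
    by (subst (2) b) (simp add: algebra_simps)
  finally have "quad (t - 2) x - x = t * (1 + 3 * (a + 3 * b * (a * a)))" .
  then show ?case by (intro exI [of _ "a + 3 * b * (a * a)"]) simp
next
  case (Suc j)
  define N :: nat where "N = 3 ^ j"
  define F where "F = quad (t - 2) ^^ N"
  define D where "D = F x - x"
  obtain e where e: "D = 3 ^ j * t * (1 + 3 * e)"
    using Suc unfolding D_def F_def N_def by blast
  have near: "t dvd F u - 2" if "t dvd u - 2" for u
    unfolding F_def by (rule quad_funpow_near_2 [OF that])
  have F_diff: "\<exists>e. F (F u) - F u = (F u - u) * (4 ^ N + 9 * e)" if "t dvd u - 2" for u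
    unfolding F_def
    by (rule quad_funpow_diff [OF assms(1) near [OF that, unfolded F_def] that])
  obtain e1 where e1: "F (F x) - F x = D * (4 ^ N + 9 * e1)"
    using F_diff [OF assms(2)] unfolding D_def by (rule exE)
  obtain e2 where e2: "F (F (F x)) - F (F x) = D * (4 ^ N + 9 * e1) * (4 ^ N + 9 * e2)"
    using F_diff [OF near [OF assms(2)]] unfolding e1 by (rule exE)
  obtain a where a: "(4 :: 'a) ^ N = 1 + 3 * a" using pow4_mod_3 by blast
  \<comment> \<open>\<open>3 * (1 + 3 * s)\<close> is \<open>1 + 4 ^ N + 16 ^ N\<close> with the error terms \<open>9 * e1\<close>, \<open>9 * e2\<close> included.\<close>
  define s where "s = a + a * a + e1 * (2 + 3 * a) + e2 * (1 + 3 * a) + 9 * e1 * e2"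
  have "(quad (t - 2) ^^ (3 ^ Suc j)) x = F (F (F x))"
  proof -
    have "3 ^ Suc j = N + (N + N)" by (simp add: N_def)
    then show ?thesis by (simp only: funpow_add F_def comp_apply)
  qed
  then have "(quad (t - 2) ^^ (3 ^ Suc j)) x - x
      = (F (F (F x)) - F (F x)) + (F (F x) - F x) + D"
    by (simp add: D_def)
  also have "\<dots> = D * ((4 ^ N + 9 * e1) * (4 ^ N + 9 * e2) + (4 ^ N + 9 * e1) + 1)"
    unfolding e1 e2 by (simp add: algebra_simps)
  also have "\<dots> = D * (3 * (1 + 3 * s))"
    unfolding a s_def by (simp add: algebra_simps)
  also have "\<dots> = 3 ^ Suc j * t * (1 + 3 * (e + s + 3 * e * s))"
    unfolding e by (simp add: algebra_simps)
  finally have "(quad (t - 2) ^^ (3 ^ Suc j)) x - x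
      = 3 ^ Suc j * t * (1 + 3 * (e + s + 3 * e * s))" .
  then show ?case by blast
qed

text \<open>Each of the \<open>q\<close> blocks of \<open>3 ^ j\<close> steps starts again in the class of \<open>2\<close>, so by
  \<open>quad_funpow_pow3\<close> all of them contribute the same amount up to multiples of \<open>3 ^ (j + 1) * t\<close>.\<close>

lemma quad_funpow_displacement:
  fixes t x :: "'a :: comm_ring_1"
  assumes "9 dvd t" and "t dvd x - 2"
  shows "\<exists>e. (quad (t - 2) ^^ (3 ^ j * q)) x - x = 3 ^ j * t * (of_nat q + 3 * e)"
proof (induction q)
  case 0
  show ?case by (rule exI [of _ 0]) simp
next
  case (Suc q)
  define y where "y = (quad (t - 2) ^^ (3 ^ j * q)) x"
  obtain e where e: "y - x = 3 ^ j * t * (of_nat q + 3 * e)"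
    using Suc unfolding y_def by blast
  have "t dvd y - 2" unfolding y_def by (rule quad_funpow_near_2 [OF assms(2)])
  then obtain d where d: "(quad (t - 2) ^^ (3 ^ j)) y - y = 3 ^ j * t * (1 + 3 * d)"
    using quad_funpow_pow3 [OF assms(1)] by blast
  have "(quad (t - 2) ^^ (3 ^ j * Suc q)) x - x
      = ((quad (t - 2) ^^ (3 ^ j)) y - y) + (y - x)"
    by (simp add: y_def funpow_add)
  also have "\<dots> = 3 ^ j * t * (of_nat (Suc q) + 3 * (e + d))"
    unfolding e d by (simp add: algebra_simps)
  finally show ?case by blast
qed

section \<open>Exact divisibility by powers of 3\<close>

text \<open>The residue of \<open>3 * x\<close> modulo \<open>3 ^ Suc n\<close> determines that of \<open>x\<close> modulo \<open>3 ^ n\<close>.\<close>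

lemma z3_mult_3_eq_0:
  fixes x :: z3
  assumes "3 * x = 0"
  shows "x = 0"
proof (rule z3_eqI)
  fix n
  have "Rep_z3 (3 * x) (Suc n) = (3 * Rep_z3 x (Suc n)) mod 3 ^ Suc n"
    using Rep_z3_numeral_pow [of 1 "Suc n"] by (simp add: times_z3.rep_eq mod_mult_left_eq)
  with assms have "(3 * Rep_z3 x (Suc n)) mod (3 * 3 ^ n) = 0"
    by (simp add: zero_z3.rep_eq)
  then have "Rep_z3 x (Suc n) mod 3 ^ n = 0"
    by (simp only: mult_mod_right [symmetric])
  then show "Rep_z3 x n = Rep_z3 0 n"
    by (simp add: Rep_z3_Suc zero_z3.rep_eq)
qed

lemma z3_pow3_mult_dvd_cancel:
  fixes x y :: z3
  assumes "3 ^ j * x dvd 3 ^ j * y"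
  shows "x dvd y"
  using assms
proof (induction j)
  case (Suc j)
  from Suc.prems obtain z where "3 ^ Suc j * y = 3 ^ Suc j * x * z" by (rule dvdE)
  then have "3 * (3 ^ j * y - 3 ^ j * x * z) = 0" by (simp add: algebra_simps)
  then have "3 ^ j * y = 3 ^ j * x * z" using z3_mult_3_eq_0 by fastforce
  then show ?case using Suc.IH by simp
qed simp

lemma z3_not_3_dvd_1: "\<not> (3 :: z3) dvd 1"
  using pow_dvd_imp_Rep_z3 [of 1 1] by (auto simp: one_z3.rep_eq)

lemma not_pow3_dvd_mult_of_nat:
  fixes t e :: "'a :: comm_ring_1"
  assumes t: "3 ^ k dvd t" "\<not> 3 ^ Suc k dvd t" and q: "\<not> 3 dvd q"
  shows "\<not> 3 ^ Suc k dvd t * (of_nat q + 3 * e)"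
proof
  assume dvd: "3 ^ Suc k dvd t * (of_nat q + 3 * e)"
  have t3: "3 ^ Suc k dvd t * (3 * s)" for s
    using mult_dvd_mono [OF t(1), of 3 "3 * s"] by (simp add: mult.commute)
  \<comment> \<open>As \<open>q\<^sup>2\<close> is congruent to \<open>1\<close> modulo \<open>3\<close>, multiplying by \<open>q\<close> recovers \<open>t\<close> up to multiples
    of \<open>3 * t\<close>.\<close>
  have "q mod 3 = 1 \<or> q mod 3 = 2" using q by presburger
  then have "(q * q) mod 3 = 1"
    using mod_mult_cong [of q 3 1 q 1] mod_mult_cong [of q 3 2 q 2] by auto
  then have "q * q = 1 + 3 * (q * q div 3)" by presburger
  then have "of_nat (q * q) = (of_nat (1 + 3 * (q * q div 3)) :: 'a)" by (rule arg_cong)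
  then have qq: "of_nat q * of_nat q = 1 + 3 * (of_nat (q * q div 3) :: 'a)" by simp
  have "t * (of_nat q + 3 * e) * of_nat q
      = t * (of_nat q * of_nat q) + t * (3 * (e * of_nat q))"
    by (simp add: algebra_simps)
  also have "\<dots> = t + t * (3 * (of_nat (q * q div 3) + e * of_nat q))"
    unfolding qq by (simp add: algebra_simps)
  finally have "3 ^ Suc k dvd t + t * (3 * (of_nat (q * q div 3) + e * of_nat q))"
    using dvd_mult2 [OF dvd, of "of_nat q"] by simp
  then show False using t(2) t3 by (simp only: dvd_add_left_iff)
qed

section \<open>Tail and cycle length\<close>

text \<open>Modulo \<open>3\<close> the orbit is \<open>0, 1, 2, 2, \<dots>\<close>.\<close>

lemma quad_orbit_0_tail:
  fixes t :: z3
  assumes t: "3 dvd t" and "n \<ge> 1"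
    and rep: "3 dvd (quad (t - 2) ^^ (m + n)) 0 - (quad (t - 2) ^^ m) 0"
  shows "m \<ge> 2"
proof (rule ccontr)
  let ?x = "\<lambda>m. (quad (t - 2) ^^ m) 0"
  have x2: "3 dvd ?x l - 2" if "l \<ge> 2" for l
    using quad_orbit_0_near_2 [OF that] t by (rule dvd_trans [rotated])
  have x1: "3 dvd ?x 1 - 1"
  proof -
    have "?x 1 - 1 = t - 3" by (simp add: quad_def)
    also have "3 dvd t - 3" using t by simp
    finally show ?thesis .
  qed
  assume "\<not> m \<ge> 2"
  then consider "m = 0" "n = 1" | "m = 0" "n \<ge> 2" | "m = 1"
    using \<open>n \<ge> 1\<close> by linarith
  then show False
  proof cases
    case 1
    with rep have "3 dvd ?x 1" by simp
    from dvd_diff [OF this x1] show False using z3_not_3_dvd_1 by simp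
  next
    case 2
    with rep have "3 dvd ?x n" by simp
    from dvd_diff [OF this x2 [OF 2(2)]] have "3 dvd (2 :: z3)" by simp
    from dvd_diff [OF dvd_refl this] show False using z3_not_3_dvd_1 by simp
  next
    case 3
    have "3 dvd ?x (m + n) - 2" by (rule x2) (use 3 \<open>n \<ge> 1\<close> in simp)
    from dvd_diff [OF dvd_add [OF rep x1] this] 3 show False
      using z3_not_3_dvd_1 by simp
  qed
qed

theorem theorem1p5:
  fixes c :: z3 and k :: nat
  assumes "c \<in> disk3 (-2) (1 / 9)"
    and "cong_mod (3 ^ k) c (-2)"
    and "\<not> cong_mod (3 ^ (k + 1)) c (-2)"
  shows "\<forall>i :: nat. i \<ge> 1 \<longrightarrow> has_orbit_type (quad c) 0 (3 ^ (k + i)) (2, 3 ^ i)"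
proof (intro allI impI)
  fix i :: nat
  assume i: "i \<ge> 1"
  define t where "t = c + 2"
  have c: "c = t - 2" by (simp add: t_def)
  have t9: "9 dvd t"
    using assms(1) abs3_le_iff [of t 2] by (simp add: disk3_def t_def)
  have tk: "3 ^ k dvd t" "\<not> 3 ^ Suc k dvd t"
    using assms(2,3) by (simp_all add: cong_mod_def t_def)
  have t3: "3 dvd t"
    by (rule dvd_trans [OF _ t9]) (rule dvdI [of _ _ 3], simp)
  let ?x = "\<lambda>m. (quad c ^^ m) 0"
  have displacement: "\<exists>e. ?x (m + 3 ^ j * q) - ?x m = 3 ^ j * (t * (of_nat q + 3 * e))"
    if "m \<ge> 2" for m j q
    using quad_funpow_displacement [OF t9 quad_orbit_0_near_2 [OF that], of j q]
    unfolding c add.commute [of m "3 ^ j * q"] funpow_add comp_apply mult.assoc .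
  have period: "cong_mod (3 ^ (k + i)) (?x (2 + 3 ^ i)) (?x 2)"
  proof -
    obtain e where "?x (2 + 3 ^ i) - ?x 2 = 3 ^ i * (t * (1 + 3 * e))"
      using displacement [of 2 i 1] by auto
    moreover have "3 ^ i * 3 ^ k dvd 3 ^ i * (t * (1 + 3 * e))"
      using tk(1) by (intro mult_dvd_mono dvd_refl dvd_mult2)
    ultimately show ?thesis
      unfolding cong_mod_def by (simp only: power_add mult.commute [of "3 ^ k"])
  qed
  have minimal: "2 \<le> m \<and> 3 ^ i \<le> n"
    if n: "n \<ge> 1" and "cong_mod (3 ^ (k + i)) (?x (m + n)) (?x m)" for m n
  proof
    have dvd: "3 ^ (k + i) dvd ?x (m + n) - ?x m"
      using that(2) by (simp add: cong_mod_def)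
    have "(3 :: z3) dvd 3 ^ (k + i)" using i by (simp add: dvd_power)
    from this dvd have "3 dvd ?x (m + n) - ?x m" by (rule dvd_trans)
    then show m: "2 \<le> m"
      unfolding c by (rule quad_orbit_0_tail [OF t3 n])
    have "n \<noteq> 0" "\<not> is_unit (3 :: nat)" using n by simp_all
    then obtain j q where nq: "n = 3 ^ j * q" and q: "\<not> 3 dvd q"
      by (rule multiplicity_decompose')
    obtain e where e: "?x (m + n) - ?x m = 3 ^ j * (t * (of_nat q + 3 * e))"
      using displacement [OF m] unfolding nq by blast
    have "i \<le> j"
    proof (rule ccontr)
      assume "\<not> i \<le> j"
      then have "(3 :: z3) ^ (j + Suc k) dvd 3 ^ (k + i)" by (intro le_imp_power_dvd) simp
      then have "3 ^ j * 3 ^ Suc k dvd 3 ^ j * (t * (of_nat q + 3 * e))"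
        using dvd unfolding e power_add by (rule dvd_trans)
      from not_pow3_dvd_mult_of_nat [OF tk q] z3_pow3_mult_dvd_cancel [OF this]
      show False by (rule notE)
    qed
    then have "3 ^ i \<le> (3 :: nat) ^ j" by simp
    also have "\<dots> \<le> n" using n unfolding nq by (cases q) auto
    finally show "3 ^ i \<le> n" .
  qed
  show "has_orbit_type (quad c) 0 (3 ^ (k + i)) (2, 3 ^ i)"
    unfolding has_orbit_type_def prod.case
  proof (intro conjI allI impI)
    show "(1 :: nat) \<le> 3 ^ i" by simp
    show "cong_mod (3 ^ (k + i)) (?x (2 + 3 ^ i)) (?x 2)" by (rule period)
  qed (use minimal in blast)+
qed

end
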